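(* The indexing algorithm described in the context (selection, derivation, generalization, expansion and addition operations, repeated until every concept has a key) is complete. That is, for every concept hierarchy given as input, it creates an index: it produces in finite time an output consisting of a concept key for every concept and a node key for every node of the hierarchy.
   Context: Concept hierarchy: a finite rooted tree in which every node is labelled by a concept (the same concept may label several nodes), such that (i) no node has two distinct child nodes with the same concept, and (ii) the dependency graph is free of cycles. The dependency graph has the occurring concepts as vertices and an edge from $A$ to $B$ whenever some node with concept $A$ is a child of some node with concept $B$. Keys: a key $X=[a_1,\dots,a_m]$ is a finite list whose entries are constants (natural numbers) or the variable symbol $x$; different occurrences of $x$ are independent. Its length is $m$ and its $i$-th entry is written $X[i]$. A key $Y$ is an instance of a key $X$ if it has the same length and is obtained from $X$ by substituting constants for some (not necessarily all) occurrences of $x$, i.e. $Y[i]=X[i]$ whenever $X[i]\neq x$. Generalization: for keys $X_1,\dots,X_m$, the generalized key $G$ has the length of the longest $X_j$; $G[i]=n$ if $X_j[i]=n\in\mathbb{N}$ for all $X_j$ of length $\ge i$, and $G[i]=x$ otherwise. Expansion: the expansion of a key $X_1$ of length $m$ towards a key $X_2$ of length $n\ge m$ is the key of length $n$ with $i$-th entry $X_1[i]$ for $i\le m$ and $X_2[i]$ for $m<i\le n$. For a concept $B$, $\mathrm{parents}(B)$ is the set of all nodes that have a child node with concept $B$. Indexing algorithm. Input: a concept hierarchy $H$, with a counter initialized to $0$ in each node. Output: a concept key $\underline{X}_B$ for every concept $B$ and a node key $X_K$ for every node $K$. Initialization: the root node and its concept get the key $[0]$. Repeat the following until every concept has a key: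 - OP I (selection): choose a concept $B$ (without a key) such that all elements of $\mathrm{parents}(B)$ already have a node key. - OP II (derivation): for each $K\in\mathrm{parents}(B)$, generate a key, for the child of $K$ with concept $B$, by appending the current counter of $K$ to $X_K$; then raise the counter of $K$ by 1. - OP III (generalization): generalize all keys generated in OP II. If the generalized key has instances in common with an already created concept key, append further numbers to it until this is no longer the case. The result is the concept key $\underline{X}_B$. - OP IV (expansion): expand every key generated in OP II towards $\underline{X}_B$; the results are the node keys. - OP V (addition): assign these node keys to the respective nodes of $H$ with concept $B$. *)

theory Defs
  imports Main
begin

section \<open>Concept hierarchies\<close>

text \<open>Edges point from a parent node to its child nodes.\<close>

record ('n, 'c) hierarchy =
  nodes :: "'n set"
  edges :: "('n \<times> 'n) set"
  top_node :: 'n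
  concept_of :: "'n \<Rightarrow> 'c"

definition finite_rooted_tree :: "'n set \<Rightarrow> ('n \<times> 'n) set \<Rightarrow> 'n \<Rightarrow> bool" where
  "finite_rooted_tree V E r \<longleftrightarrow>
     finite V \<and> r \<in> V \<and> E \<subseteq> V \<times> V \<and>
     (\<forall>K. (K, r) \<notin> E) \<and>
     (\<forall>C\<in>V - {r}. \<exists>!K. (K, C) \<in> E) \<and>
     (\<forall>C\<in>V. (r, C) \<in> E\<^sup>*)"

definition concepts :: "('n, 'c) hierarchy \<Rightarrow> 'c set" where
  "concepts H = concept_of H ` nodes H"

definition dependency_graph :: "('n, 'c) hierarchy \<Rightarrow> ('c \<times> 'c) set" where
  "dependency_graph H = {(concept_of H C, concept_of H K) | K C. (K, C) \<in> edges H}"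

definition concept_hierarchy :: "('n, 'c) hierarchy \<Rightarrow> bool" where
  "concept_hierarchy H \<longleftrightarrow>
     finite_rooted_tree (nodes H) (edges H) (top_node H) \<and>
     (\<forall>K C D. (K, C) \<in> edges H \<and> (K, D) \<in> edges H \<and> concept_of H C = concept_of H D
        \<longrightarrow> C = D) \<and>
     acyclic (dependency_graph H)"

definition parents :: "('n, 'c) hierarchy \<Rightarrow> 'c \<Rightarrow> 'n set" where
  "parents H B = {K \<in> nodes H. \<exists>C. (K, C) \<in> edges H \<and> concept_of H C = B}"


section \<open>Keys\<close>

datatype key_entry = Const nat | Var

type_synonym key = "key_entry list"

definition instance_of :: "key \<Rightarrow> key \<Rightarrow> bool" where
  "instance_of Y X \<longleftrightarrow>
     length Y = length X \<and> (\<forall>i<length X. X ! i \<noteq> Var \<longrightarrow> Y ! i = X ! i)"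

definition common_instance :: "key \<Rightarrow> key \<Rightarrow> bool" where
  "common_instance X Y \<longleftrightarrow> (\<exists>Z. instance_of Z X \<and> instance_of Z Y)"

definition entries_at :: "key set \<Rightarrow> nat \<Rightarrow> key_entry set" where
  "entries_at S i = {X ! i | X. X \<in> S \<and> i < length X}"

text \<open>Meaningful for finite nonempty \<open>S\<close> only. Below the maximal length,
  \<open>entries_at S i\<close> is nonempty, so it equals \<open>{Const n}\<close> iff every key that is long
  enough has the constant \<open>n\<close> at position \<open>i\<close>.\<close>

definition generalization :: "key set \<Rightarrow> key" where
  "generalization S =
     map (\<lambda>i. if \<exists>n. entries_at S i = {Const n} then the_elem (entries_at S i) else Var)
       [0..<Max (length ` S)]"

text \<open>Meaningful for \<open>length X1 \<le> length X2\<close> only; the algorithm below checks this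
  condition explicitly and gets stuck if it is violated.\<close>

definition expansion :: "key \<Rightarrow> key \<Rightarrow> key" where
  "expansion X1 X2 = X1 @ drop (length X1) X2"


section \<open>The indexing algorithm\<close>

text \<open>The algorithm is a nondeterministic transition system. The control state carries the
  local data of the current round: the concept \<open>B\<close> being processed, the parents of \<open>B\<close> still
  to be visited, the keys generated so far for the children with concept \<open>B\<close>, the
  generalized key to which numbers may still be appended, and the expanded keys.\<close>

datatype ('n, 'c) control =
    Selection
  | Derivation 'c "'n set" "'n \<rightharpoonup> key"
  | Generalization 'c "'n \<rightharpoonup> key" key
  | Expansion 'c "'n \<rightharpoonup> key"
  | Addition "'n \<rightharpoonup> key"

record ('n, 'c) state =
  control :: "('n, 'c) control"
  counter :: "'n \<Rightarrow> nat"
  concept_key :: "'c \<rightharpoonup> key"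
  node_key :: "'n \<rightharpoonup> key"

definition initial_state :: "('n, 'c) hierarchy \<Rightarrow> ('n, 'c) state" where
  "initial_state H =
     \<lparr> control = Selection,
       counter = (\<lambda>_. 0),
       concept_key = [concept_of H (top_node H) \<mapsto> [Const 0]],
       node_key = [top_node H \<mapsto> [Const 0]] \<rparr>"

text \<open>The loop has ended when every concept has a key: then no concept can be selected.
  Neither the choice of the concept, nor the order in which its parents are visited, nor the
  choice of the appended numbers is restricted any further. Undefined operations (a missing
  node key, an expansion towards a shorter key) block the execution.\<close>

inductive step :: "('n, 'c) hierarchy \<Rightarrow> ('n, 'c) state \<Rightarrow> ('n, 'c) state \<Rightarrow> bool"
  for H :: "('n, 'c) hierarchy" where
  selection:
    "\<lbrakk> control s = Selection; B \<in> concepts H; concept_key s B = None;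
       \<forall>K\<in>parents H B. \<exists>X. node_key s K = Some X \<rbrakk>
     \<Longrightarrow> step H s (s\<lparr> control := Derivation B (parents H B) Map.empty \<rparr>)"
| derivation:
    "\<lbrakk> control s = Derivation B P gen; K \<in> P;
       (K, C) \<in> edges H; concept_of H C = B; node_key s K = Some X \<rbrakk>
     \<Longrightarrow> step H s (s\<lparr> control := Derivation B (P - {K}) (gen(C \<mapsto> X @ [Const (counter s K)])),
                    counter := (counter s)(K := counter s K + 1) \<rparr>)"
| generalization:
    "control s = Derivation B {} gen
     \<Longrightarrow> step H s (s\<lparr> control := Generalization B gen (generalization (ran gen)) \<rparr>)"
| append_number:
    "\<lbrakk> control s = Generalization B gen G; \<exists>Y\<in>ran (concept_key s). common_instance G Y \<rbrakk>
     \<Longrightarrow> step H s (s\<lparr> control := Generalization B gen (G @ [Const k]) \<rparr>)"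
| set_concept_key:
    "\<lbrakk> control s = Generalization B gen G; \<not> (\<exists>Y\<in>ran (concept_key s). common_instance G Y) \<rbrakk>
     \<Longrightarrow> step H s (s\<lparr> control := Expansion B gen,
                    concept_key := (concept_key s)(B \<mapsto> G) \<rparr>)"
| expansion:
    "\<lbrakk> control s = Expansion B gen; concept_key s B = Some G;
       \<forall>X\<in>ran gen. length X \<le> length G \<rbrakk>
     \<Longrightarrow> step H s (s\<lparr> control := Addition (\<lambda>C. map_option (\<lambda>X. expansion X G) (gen C)) \<rparr>)"
| addition:
    "control s = Addition new
     \<Longrightarrow> step H s (s\<lparr> control := Selection, node_key := node_key s ++ new \<rparr>)"

end

theory Submission
  imports Defs
begin

text \<open>Termination: a generalized key has instances in common only with concept keys of its own
  length, so appending ends once it is longer than all of them, and every round gives a key to a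
  concept that had none. Progress: the dependency graph is finite and acyclic, so
  as long as some concept lacks a key, a minimal such concept exists; all its parents carry concepts
  that have a key already, hence have a node key, and the concept can be selected.\<close>

section \<open>Structure of concept hierarchies\<close>

text \<open>All nodes of a concept receive their keys together, so between rounds
  \<open>dom (node_key s)\<close> has this form.\<close>

definition labelled :: "('n, 'c) hierarchy \<Rightarrow> 'c set \<Rightarrow> 'n set" where
  "labelled H D = {K \<in> nodes H. concept_of H K \<in> D}"

lemma finite_concepts: "concept_hierarchy H \<Longrightarrow> finite (concepts H)"
  by (simp add: concept_hierarchy_def finite_rooted_tree_def concepts_def)

lemma finite_parents: "concept_hierarchy H \<Longrightarrow> finite (parents H B)"
  by (simp add: concept_hierarchy_def finite_rooted_tree_def parents_def)

lemma finite_labelled: "concept_hierarchy H \<Longrightarrow> finite (labelled H D)"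
  by (simp add: concept_hierarchy_def finite_rooted_tree_def labelled_def)

lemma edge_in_nodes:
  "concept_hierarchy H \<Longrightarrow> (K, C) \<in> edges H \<Longrightarrow> K \<in> nodes H \<and> C \<in> nodes H"
  by (auto simp: concept_hierarchy_def finite_rooted_tree_def)

lemma child_with_concept_unique:
  "concept_hierarchy H \<Longrightarrow> (K, C) \<in> edges H \<Longrightarrow> (K, D) \<in> edges H \<Longrightarrow>
    concept_of H C = concept_of H D \<Longrightarrow> C = D"
  unfolding concept_hierarchy_def by blast

text \<open>Every tree edge gives a dependency edge in the opposite direction, so extending a path
  downwards prepends an edge to its image.\<close>

lemma dependency_graph_descendant:
  "(K, C) \<in> (edges H)\<^sup>+ \<Longrightarrow> (concept_of H C, concept_of H K) \<in> (dependency_graph H)\<^sup>+"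
proof (induction rule: trancl_induct)
  case (base C)
  then show ?case unfolding dependency_graph_def by blast
next
  case (step C D)
  then have "(concept_of H D, concept_of H C) \<in> dependency_graph H"
    unfolding dependency_graph_def by blast
  with step.IH show ?case by (rule trancl_into_trancl2[rotated])
qed

text \<open>A second node with the concept of the root would be a proper descendant of the root and
  close a cycle in the dependency graph.\<close>

lemma labelled_top_concept:
  assumes "concept_hierarchy H"
  shows "labelled H {concept_of H (top_node H)} = {top_node H}"
proof -
  have "K = top_node H"
    if K: "K \<in> nodes H" "concept_of H K = concept_of H (top_node H)" for K
  proof (rule ccontr)
    assume "K \<noteq> top_node H"
    moreover have "(top_node H, K) \<in> (edges H)\<^sup>*"
      using assms K by (auto simp: concept_hierarchy_def finite_rooted_tree_def)
    ultimately have "(top_node H, K) \<in> (edges H)\<^sup>+"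
      by (simp add: rtrancl_eq_or_trancl)
    then have "(concept_of H K, concept_of H (top_node H)) \<in> (dependency_graph H)\<^sup>+"
      by (rule dependency_graph_descendant)
    with K assms show False by (auto simp: concept_hierarchy_def acyclic_def)
  qed
  then show ?thesis
    using assms by (auto simp: labelled_def concept_hierarchy_def finite_rooted_tree_def)
qed

text \<open>Every node except the root has a parent, so visiting all parents of \<open>B\<close>
  reaches all nodes that need a key.\<close>

lemma children_of_parents:
  assumes "concept_hierarchy H" "B \<noteq> concept_of H (top_node H)"
  shows "{C. \<exists>K\<in>parents H B. (K, C) \<in> edges H \<and> concept_of H C = B} = labelled H {B}"
proof -
  have "\<exists>K\<in>parents H B. (K, C) \<in> edges H" if C: "C \<in> nodes H" "concept_of H C = B" for C
  proof -
    have "C \<in> nodes H - {top_node H}" using C assms(2) by auto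
    then obtain K where "(K, C) \<in> edges H"
      using assms(1) unfolding concept_hierarchy_def finite_rooted_tree_def by blast
    then show ?thesis using C edge_in_nodes[OF assms(1)] unfolding parents_def by blast
  qed
  then show ?thesis using edge_in_nodes[OF assms(1)] by (auto simp: labelled_def)
qed

text \<open>The converse is taken so that the concepts of parents count as smaller.\<close>

lemma wf_dependency_graph:
  assumes "concept_hierarchy H"
  shows "wf ((dependency_graph H)\<inverse>)"
proof -
  have "dependency_graph H \<subseteq> concepts H \<times> concepts H"
    using edge_in_nodes[OF assms] by (auto simp: dependency_graph_def concepts_def)
  then have "finite (dependency_graph H)"
    using finite_concepts[OF assms] finite_subset by blast
  then show ?thesis
    using assms by (simp add: finite_acyclic_wf_converse concept_hierarchy_def)
qed

lemma selectable_concept: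
  assumes "concept_hierarchy H" "U \<noteq> {}"
  obtains B where "B \<in> U" "\<And>K. K \<in> parents H B \<Longrightarrow> concept_of H K \<notin> U"
proof -
  obtain B where B: "B \<in> U" "\<And>A. (A, B) \<in> (dependency_graph H)\<inverse> \<Longrightarrow> A \<notin> U"
    using wfE_min'[OF wf_dependency_graph[OF assms(1)] assms(2)] by blast
  moreover have "(concept_of H K, B) \<in> (dependency_graph H)\<inverse>" if "K \<in> parents H B" for K
    using that by (auto simp: parents_def dependency_graph_def)
  ultimately show ?thesis using that by blast
qed

section \<open>Lengths of keys\<close>

lemma length_generalization:
  "finite S \<Longrightarrow> X \<in> S \<Longrightarrow> length X \<le> length (generalization S)"
  by (simp add: generalization_def)

lemma common_instance_length: "common_instance X Y \<Longrightarrow> length X = length Y"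
  by (auto simp: common_instance_def instance_of_def)


section \<open>The invariant and its preservation\<close>

text \<open>The length bounds keep the guard of the expansion step satisfiable. In
  \<open>Expansion\<close>, \<open>B\<close> already has its concept key while its nodes still lack
  theirs, hence the \<open>- {B}\<close>.\<close>

definition invariant :: "('n, 'c) hierarchy \<Rightarrow> ('n, 'c) state \<Rightarrow> bool" where
  "invariant H s \<longleftrightarrow>
     concept_of H (top_node H) \<in> dom (concept_key s) \<and>
     dom (concept_key s) \<subseteq> concepts H \<and>
     (case control s of
        Selection \<Rightarrow> dom (node_key s) = labelled H (dom (concept_key s))
      | Derivation B P gen \<Rightarrow>
          B \<in> concepts H - dom (concept_key s) \<and>
          dom (node_key s) = labelled H (dom (concept_key s)) \<and>
          P \<subseteq> parents H B \<and> parents H B \<subseteq> dom (node_key s) \<and>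
          dom gen = {C. \<exists>K\<in>parents H B - P. (K, C) \<in> edges H \<and> concept_of H C = B}
      | Generalization B gen G \<Rightarrow>
          B \<in> concepts H - dom (concept_key s) \<and>
          dom (node_key s) = labelled H (dom (concept_key s)) \<and>
          dom gen = labelled H {B} \<and> (\<forall>X\<in>ran gen. length X \<le> length G)
      | Expansion B gen \<Rightarrow>
          dom (node_key s) = labelled H (dom (concept_key s) - {B}) \<and>
          dom gen = labelled H {B} \<and>
          (\<exists>G. concept_key s B = Some G \<and> (\<forall>X\<in>ran gen. length X \<le> length G))
      | Addition new \<Rightarrow>
          dom (node_key s) \<union> dom new = labelled H (dom (concept_key s)))"

lemma invariant_initial:
  assumes "concept_hierarchy H"
  shows "invariant H (initial_state H)"
proof -
  have "top_node H \<in> nodes H"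
    using assms by (simp add: concept_hierarchy_def finite_rooted_tree_def)
  then show ?thesis
    using labelled_top_concept[OF assms]
    by (simp add: invariant_def initial_state_def concepts_def)
qed

lemma invariant_step:
  assumes H: "concept_hierarchy H" and "step H s t" "invariant H s"
  shows "invariant H t"
  using assms(2,3)
proof cases
  case (selection B)
  then have "parents H B \<subseteq> dom (node_key s)" by blast
  with selection assms(3) show ?thesis by (auto simp: invariant_def)
next
  case (derivation B P gen K C X)
  then have K: "K \<in> parents H B" and P: "P \<subseteq> parents H B"
    and gen: "dom gen = {C. \<exists>K\<in>parents H B - P. (K, C) \<in> edges H \<and> concept_of H C = B}"
    using assms(3) by (auto simp: invariant_def)
  \<comment> \<open>Siblings carry distinct concepts, so visiting \<open>K\<close> contributes
    exactly one node to \<open>dom gen\<close>.\<close>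
  have "D = C" if "(K, D) \<in> edges H" "concept_of H D = B" for D
    using child_with_concept_unique[OF H] that derivation by metis
  then have "insert C (dom gen) =
      {C. \<exists>K'\<in>parents H B - (P - {K}). (K', C) \<in> edges H \<and> concept_of H C = B}"
    using K gen derivation by blast
  with derivation P assms(3) show ?thesis by (auto simp: invariant_def)
next
  case (generalization B gen)
  \<comment> \<open>The root concept has a key from the start, whereas \<open>B\<close> has
    none.\<close>
  then have "B \<noteq> concept_of H (top_node H)"
    using assms(3) by (auto simp: invariant_def)
  then have gen: "dom gen = labelled H {B}"
    using children_of_parents[OF H, of B] generalization assms(3) by (simp add: invariant_def)
  then have "finite (ran gen)" using finite_labelled[OF H] by (simp add: finite_ran)
  then show ?thesis
    using generalization gen assms(3) length_generalization by (auto simp: invariant_def)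
next
  case (append_number B gen G k)
  then show ?thesis using assms(3) by (auto simp: invariant_def)
next
  case (set_concept_key B gen G)
  then have "insert B (dom (concept_key s)) - {B} = dom (concept_key s)"
    using assms(3) by (auto simp: invariant_def)
  then show ?thesis using set_concept_key assms(3) by (auto simp: invariant_def)
next
  case (expansion B gen G)
  have "dom (\<lambda>C. map_option (\<lambda>X. Defs.expansion X G) (gen C)) = dom gen"
    by (auto simp: dom_def)
  moreover have "labelled H (dom (concept_key s) - {B}) \<union> labelled H {B} =
      labelled H (dom (concept_key s))"
    using expansion by (auto simp: labelled_def)
  ultimately show ?thesis using expansion assms(3) by (simp add: invariant_def)
next
  case (addition new)
  then show ?thesis using assms(3) by (simp add: invariant_def Un_commute)
qed

section \<open>Absence of deadlocks\<close>

lemma invariant_progress: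
  assumes H: "concept_hierarchy H" and inv: "invariant H s" and stuck: "\<nexists>t. step H s t"
  shows "control s = Selection" "concepts H \<subseteq> dom (concept_key s)"
proof -
  show sel: "control s = Selection"
  proof (cases "control s")
    case (Derivation B P gen)
    show ?thesis
    proof (cases "P = {}")
      case True
      then show ?thesis using Derivation stuck step.generalization[of s B gen H] by blast
    next
      case False
      then obtain K where K: "K \<in> P" by blast
      have "P \<subseteq> parents H B" "parents H B \<subseteq> dom (node_key s)"
        using inv unfolding invariant_def Derivation control.case by blast+
      with K have "K \<in> parents H B" "K \<in> dom (node_key s)" by blast+
      then obtain C X where "(K, C) \<in> edges H" "concept_of H C = B" "node_key s K = Some X"
        by (auto simp: parents_def)
      then show ?thesis using step.derivation[OF Derivation K] stuck by metis
    qed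
  next
    case (Generalization B gen G)
    show ?thesis
    proof (cases "\<exists>Y\<in>ran (concept_key s). common_instance G Y")
      case True
      then show ?thesis using step.append_number[OF Generalization] stuck by metis
    next
      case False
      then show ?thesis using step.set_concept_key[OF Generalization] stuck by metis
    qed
  next
    case (Expansion B gen)
    with inv obtain G where "concept_key s B = Some G" "\<forall>X\<in>ran gen. length X \<le> length G"
      by (auto simp: invariant_def)
    then show ?thesis using step.expansion[OF Expansion] stuck by metis
  next
    case (Addition new)
    show ?thesis using step.addition[OF Addition, of H] stuck by metis
  qed
  show "concepts H \<subseteq> dom (concept_key s)"
  proof (rule ccontr)
    assume "\<not> ?thesis"
    then have "concepts H - dom (concept_key s) \<noteq> {}" by blast
    then obtain B where B: "B \<in> concepts H - dom (concept_key s)"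
      "\<And>K. K \<in> parents H B \<Longrightarrow> concept_of H K \<notin> concepts H - dom (concept_key s)"
      using selectable_concept[OF H] by metis
    \<comment> \<open>Parents are nodes, so their concepts lie in \<open>concepts H\<close> and can
      avoid the keyless set only by having a key.\<close>
    then have "parents H B \<subseteq> labelled H (dom (concept_key s))"
      by (auto simp: labelled_def parents_def concepts_def)
    also have "\<dots> = dom (node_key s)" using inv sel by (simp add: invariant_def)
    finally have "\<forall>K\<in>parents H B. \<exists>X. node_key s K = Some X" by auto
    with B(1) have "step H s (s\<lparr>control := Derivation B (parents H B) Map.empty\<rparr>)"
      by (intro step.selection[OF sel]) auto
    with stuck show False by blast
  qed
qed

section \<open>Termination measure\<close>

text \<open>Assigning the concept key decreases the number of concepts without a key, so the controls
  \<open>Expansion\<close> and \<open>Addition\<close> belong to the next round and rank above \<open>Selection\<close>.\<close>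

fun control_rank :: "('n, 'c) control \<Rightarrow> nat" where
  "control_rank Selection = 2"
| "control_rank (Derivation B P gen) = 1"
| "control_rank (Generalization B gen G) = 0"
| "control_rank (Expansion B gen) = 4"
| "control_rank (Addition new) = 3"

text \<open>The \<open>Suc\<close> keeps the truncated difference positive while \<open>G\<close> is
  no longer than the longest concept key, so each appended number lowers it. The other controls are
  left after one step, which lowers an earlier component.\<close>

fun work_left :: "('n, 'c) state \<Rightarrow> ('n, 'c) control \<Rightarrow> nat" where
  "work_left s (Derivation B P gen) = card P"
| "work_left s (Generalization B gen G) =
     Suc (Max (length ` ran (concept_key s))) - length G"
| "work_left s _ = 0"

definition step_measure :: "('n, 'c) hierarchy \<Rightarrow> ('n, 'c) state \<Rightarrow> nat \<times> nat \<times> nat" where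
  "step_measure H s = (card (concepts H - dom (concept_key s)),
     control_rank (control s), work_left s (control s))"

lemma step_measure_decreases:
  assumes H: "concept_hierarchy H" and "step H s t" "invariant H s"
  shows "(step_measure H t, step_measure H s) \<in> less_than <*lex*> less_than <*lex*> less_than"
  using assms(2)
proof cases
  case (derivation B P gen K C X)
  then have "finite P"
    using assms(3) finite_parents[OF H] finite_subset by (auto simp: invariant_def)
  then have "card (P - {K}) < card P" using derivation by (intro card_Diff1_less)
  with derivation show ?thesis by (simp add: step_measure_def del: card_Diff_singleton)
next
  case (append_number B gen G k)
  have "finite (ran (concept_key s))"
    using assms(3) finite_concepts[OF H] finite_subset
    by (auto simp: invariant_def intro!: finite_ran)
  \<comment> \<open>The guard of the step supplies a concept key sharing an instance with
    \<open>G\<close>, hence of the same length.\<close>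
  moreover have "length G \<in> length ` ran (concept_key s)"
    using append_number common_instance_length by auto
  ultimately have "length G \<le> Max (length ` ran (concept_key s))" by simp
  with append_number show ?thesis by (simp add: step_measure_def)
next
  case (set_concept_key B gen G)
  then have "B \<in> concepts H - dom (concept_key s)"
    using assms(3) by (simp add: invariant_def)
  then have "card (concepts H - insert B (dom (concept_key s))) <
      card (concepts H - dom (concept_key s))"
    using finite_concepts[OF H] by (intro psubset_card_mono) auto
  with set_concept_key show ?thesis by (simp add: step_measure_def)
qed (auto simp: step_measure_def)

text \<open>The steps are nondeterministic and may block, so termination of every run is
  complemented by the claim that a state without successor is a finished index and not a
  deadlock.\<close>

theorem proposition3:
  fixes H :: "('n, 'c) hierarchy"
  assumes "concept_hierarchy H"
  shows "(\<nexists>run. run 0 = initial_state H \<and> (\<forall>i::nat. step H (run i) (run (Suc i)))) \<and>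
    (\<forall>s. (step H)\<^sup>*\<^sup>* (initial_state H) s \<and> (\<nexists>t. step H s t) \<longrightarrow>
       control s = Selection \<and> dom (concept_key s) = concepts H \<and> dom (node_key s) = nodes H)"
proof (intro conjI allI impI notI)
  assume "\<exists>run. run 0 = initial_state H \<and> (\<forall>i::nat. step H (run i) (run (Suc i)))"
  then obtain run where run: "run 0 = initial_state H" "\<And>i. step H (run i) (run (Suc i))"
    by blast
  have "invariant H (run i)" for i
    by (induction i)
      (simp_all add: run(1) invariant_initial[OF assms] invariant_step[OF assms run(2)])
  then have "\<forall>i. (step_measure H (run (Suc i)), step_measure H (run i))
      \<in> less_than <*lex*> less_than <*lex*> less_than"
    using step_measure_decreases[OF assms run(2)] by blast
  moreover have "wf (less_than <*lex*> less_than <*lex*> less_than)"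
    by (intro wf_lex_prod wf_less_than)
  ultimately show False
    unfolding wf_iff_no_infinite_down_chain
    by (elim notE) (rule exI[of _ "\<lambda>i. step_measure H (run i)"])
next
  fix s
  assume s: "(step H)\<^sup>*\<^sup>* (initial_state H) s \<and> (\<nexists>t. step H s t)"
  then have "(step H)\<^sup>*\<^sup>* (initial_state H) s" ..
  then have inv: "invariant H s"
    by (induction rule: rtranclp_induct)
      (use invariant_initial invariant_step assms in blast)+
  show sel: "control s = Selection"
    using invariant_progress(1)[OF assms inv] s by blast
  show ck: "dom (concept_key s) = concepts H"
    using invariant_progress(2)[OF assms inv] s inv by (auto simp: invariant_def)
  \<comment> \<open>Once all concepts have keys, \<open>labelled\<close> selects every node.\<close>
  show "dom (node_key s) = nodes H"
    using inv sel ck by (auto simp: invariant_def labelled_def concepts_def)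
qed

end
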